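(* Every permutation $\pi$ of $N\ge 2$ elements can be implemented by a quantum circuit on a single register of $n=\lceil\log_2 N\rceil$ qubits, without ancillary qubits, using $O(N^2\log_2N)$ gates from the gate set consisting of one-qubit $X$ gates, CNOT gates and the standard $n$-qubit Toffoli gate.
   Context: The canonical basis of $\mathbb{C}^{2^n}=(\mathbb{C}^2)^{\otimes n}$ is $\{|q\rangle : 0\le q\le 2^n-1\}$, with $|q\rangle=|q_{n-1}\cdots q_0\rangle$, $q=\sum_j q_j2^j$. A circuit implements a permutation $\pi$ of $\{0,\ldots,N-1\}$ if its unitary is the permutation matrix of $\pi$, where $\pi$ is regarded as a permutation of the basis labels $\{0,\ldots,2^n-1\}$ fixing all labels $\ge N$. The standard $n$-qubit Toffoli gate flips the last qubit (bit $q_0$) if and only if the other $n-1$ qubits are all in state $|1\rangle$, and counts as one gate (for $n=1$ it is the $X$ gate). *)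

theory Defs
  imports
    Complex_Main
    "HOL-Combinatorics.Permutations"
    "Jordan_Normal_Form.Matrix"
begin

(* Basis labels of an n-qubit register are the naturals q < 2^n; the state of qubit j
   is the binary digit "bit q j", so qubit 0 is the last qubit of |q_{n-1} ... q_0>. *)

datatype gate =
    X_gate nat
  | CNOT_gate nat nat  \<comment> \<open>control, target\<close>
  | Toffoli_gate       \<comment> \<open>acts on the whole register, target qubit 0\<close>

fun valid_gate :: "nat \<Rightarrow> gate \<Rightarrow> bool" where
  "valid_gate n (X_gate k) \<longleftrightarrow> k < n"
| "valid_gate n (CNOT_gate c t) \<longleftrightarrow> c < n \<and> t < n \<and> c \<noteq> t"
| "valid_gate n Toffoli_gate \<longleftrightarrow> 0 < n"

fun gate_action :: "nat \<Rightarrow> gate \<Rightarrow> nat \<Rightarrow> nat" where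
  "gate_action n (X_gate k) q = flip_bit k q"
| "gate_action n (CNOT_gate c t) q = (if bit q c then flip_bit t q else q)"
| "gate_action n Toffoli_gate q = (if \<forall>j\<in>{1..<n}. bit q j then flip_bit 0 q else q)"

(* The matrix sending the basis vector |q> to |f q>: column q has its 1 in row f q. *)
definition basis_map_matrix :: "nat \<Rightarrow> (nat \<Rightarrow> nat) \<Rightarrow> complex mat" where
  "basis_map_matrix n f = mat (2 ^ n) (2 ^ n) (\<lambda>(r, q). if r = f q then 1 else 0)"

definition gate_unitary :: "nat \<Rightarrow> gate \<Rightarrow> complex mat" where
  "gate_unitary n g = basis_map_matrix n (gate_action n g)"

type_synonym circuit = "gate list"

definition valid_circuit :: "nat \<Rightarrow> circuit \<Rightarrow> bool" where
  "valid_circuit n gs \<longleftrightarrow> (\<forall>g\<in>set gs. valid_gate n g)"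

(* The head of the list is applied first, i.e. it is the rightmost factor of the product. *)
fun circuit_unitary :: "nat \<Rightarrow> circuit \<Rightarrow> complex mat" where
  "circuit_unitary n [] = 1\<^sub>m (2 ^ n)"
| "circuit_unitary n (g # gs) = circuit_unitary n gs * gate_unitary n g"

(* For p permuting {..<N} with N <= 2^n, "permutes" makes p fix every label >= N. *)
definition implements :: "nat \<Rightarrow> circuit \<Rightarrow> (nat \<Rightarrow> nat) \<Rightarrow> bool" where
  "implements n gs p \<longleftrightarrow> valid_circuit n gs \<and> circuit_unitary n gs = basis_map_matrix n p"

end

(* A transposition (a b) of labels costs O(n) gates. X gates translate the labels by b (bitwise
   exclusive or), which sends b to 0 and a to some nonzero label; CNOT gates fix 0 and carry that
   label to 1; finally X gates move 0 and 1 to the two labels 2^n - 2 and 2^n - 1 that the Toffoli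
   gate exchanges. Conjugating the Toffoli gate by this circuit gives (a b). Since a permutation of
   N labels is a product of at most N transpositions, O(N log N) gates suffice. *)

theory Submission
  imports Defs
begin

subsection \<open>The action of a circuit on basis labels\<close>

lemma flip_bit_less_exp:
  fixes q :: nat
  assumes "k < n" "q < 2 ^ n"
  shows "flip_bit k q < 2 ^ n"
proof -
  have "take_bit n q = q"
    using assms(2) by (simp add: take_bit_nat_eq_self)
  then have "j < n" if "bit q j" for j
    using that by (metis bit_take_bit_iff)
  then have "take_bit n (flip_bit k q) = flip_bit k q"
    using assms(1) by (intro bit_eqI) (auto simp: bit_take_bit_iff bit_flip_bit_iff)
  then show ?thesis
    by (simp only: take_bit_nat_eq_self_iff)
qed

lemma gate_action_less_exp:
  assumes "valid_gate n g" "q < 2 ^ n"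
  shows "gate_action n g q < 2 ^ n"
  using assms by (cases g) (auto simp: flip_bit_less_exp)

text \<open>No gate flips a bit that its own condition reads: a CNOT has distinct control and
  target, and the Toffoli gate tests only bits from 1 upwards. So the condition gives the same
  answer after the flip.\<close>

lemma gate_action_involutive:
  assumes "valid_gate n g"
  shows "gate_action n g (gate_action n g q) = q"
proof -
  have "flip_bit k (flip_bit k q) = q" for k
    by (rule bit_eqI) (auto simp: bit_flip_bit_iff)
  then show ?thesis
    using assms by (cases g) (auto simp: bit_flip_bit_iff)
qed

lemma valid_circuit_simps [simp]:
  "valid_circuit n []"
  "valid_circuit n (g # gs) \<longleftrightarrow> valid_gate n g \<and> valid_circuit n gs"
  "valid_circuit n (gs @ hs) \<longleftrightarrow> valid_circuit n gs \<and> valid_circuit n hs"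
  "valid_circuit n (rev gs) \<longleftrightarrow> valid_circuit n gs"
  by (auto simp: valid_circuit_def)

lemma fold_gate_action_less_exp:
  assumes "valid_circuit n gs" "q < 2 ^ n"
  shows "fold (gate_action n) gs q < 2 ^ n"
  using assms by (induction gs arbitrary: q) (auto simp: gate_action_less_exp)

text \<open>Each gate undoes itself, so running the list backwards undoes the circuit. This supplies
  the inverse half of the conjugation in \<open>transpose_circuit\<close>.\<close>

lemma fold_gate_action_rev_inverse:
  assumes "valid_circuit n gs"
  shows "fold (gate_action n) (rev gs) (fold (gate_action n) gs q) = q"
  using assms by (induction gs arbitrary: q) (auto simp: gate_action_involutive)

lemma basis_map_matrix_cong:
  assumes "\<And>q. q < 2 ^ n \<Longrightarrow> f q = g q"
  shows "basis_map_matrix n f = basis_map_matrix n g"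
  unfolding basis_map_matrix_def by (rule eq_matI) (auto simp: assms)

lemma basis_map_matrix_mult:
  assumes "\<And>q. q < 2 ^ n \<Longrightarrow> g q < 2 ^ n"
  shows "basis_map_matrix n f * basis_map_matrix n g = basis_map_matrix n (f \<circ> g)"
proof (rule eq_matI)
  fix i j
  assume "i < dim_row (basis_map_matrix n (f \<circ> g))" "j < dim_col (basis_map_matrix n (f \<circ> g))"
  then have ij: "i < 2 ^ n" "j < 2 ^ n"
    by (simp_all add: basis_map_matrix_def)
  have "(basis_map_matrix n f * basis_map_matrix n g) $$ (i, j) =
      (\<Sum>k = 0..<2 ^ n. (if i = f k then 1 else 0) * (if k = g j then 1 else (0::complex)))"
    using ij by (simp add: basis_map_matrix_def scalar_prod_def)
  also have "\<dots> = (\<Sum>k = 0..<2 ^ n. if k = g j then (if i = f k then 1 else 0) else 0)"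
    by (rule sum.cong) auto
  \<comment> \<open>Only \<open>k = g j\<close> can contribute, and the assumption on
    \<open>g\<close> puts this index inside the range of summation.\<close>
  also have "\<dots> = basis_map_matrix n (f \<circ> g) $$ (i, j)"
    using ij assms by (simp add: basis_map_matrix_def)
  finally show "(basis_map_matrix n f * basis_map_matrix n g) $$ (i, j) =
      basis_map_matrix n (f \<circ> g) $$ (i, j)" .
qed (simp_all add: basis_map_matrix_def)

text \<open>This removes matrices from the rest of the argument: \<open>fold\<close> applies the
  head first, matching its place as the rightmost factor.\<close>

lemma circuit_unitary_eq_basis_map_matrix:
  assumes "valid_circuit n gs"
  shows "circuit_unitary n gs = basis_map_matrix n (fold (gate_action n) gs)"
  using assms
proof (induction gs)
  case Nil
  show ?case
    by (rule eq_matI) (auto simp: basis_map_matrix_def)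
next
  case (Cons g gs)
  then show ?case
    by (simp add: gate_unitary_def basis_map_matrix_mult gate_action_less_exp comp_def)
qed

subsection \<open>Circuits for transpositions\<close>

text \<open>One X gate for each set bit of \<open>m\<close> below \<open>k\<close>. At
  \<open>k = n\<close> this is translation by \<open>m\<close>.\<close>

lemma X_circuit_xor:
  assumes "k \<le> n"
  shows "\<exists>gs. valid_circuit n gs \<and> length gs \<le> k \<and>
    (\<forall>q. fold (gate_action n) gs q = xor q (take_bit k m))"
  using assms
proof (induction k)
  case 0
  then show ?case
    by (intro exI[of _ "[]"]) simp
next
  case (Suc k)
  then obtain gs where gs: "valid_circuit n gs" "length gs \<le> k"
    "\<And>q. fold (gate_action n) gs q = xor q (take_bit k m)"
    by auto
  let ?hs = "gs @ (if bit m k then [X_gate k] else [])"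
  have "fold (gate_action n) ?hs q = xor q (take_bit (Suc k) m)" for q
    by (rule bit_eqI) (auto simp: gs bit_simps less_Suc_eq)
  moreover have "valid_circuit n ?hs" "length ?hs \<le> Suc k"
    using gs Suc.prems by auto
  ultimately show ?case
    by blast
qed

text \<open>One CNOT for each set bit of \<open>m\<close> below \<open>k\<close>, all controlled by
  \<open>c\<close>. As bit \<open>c\<close> of \<open>m\<close> is clear, no gate targets its own
  control, and the control keeps its value throughout.\<close>

lemma CNOT_circuit_controlled_xor:
  assumes "k \<le> n" "c < n" "\<not> bit m c"
  shows "\<exists>gs. valid_circuit n gs \<and> length gs \<le> k \<and>
    (\<forall>q. fold (gate_action n) gs q = (if bit q c then xor q (take_bit k m) else q))"
  using assms(1)
proof (induction k)
  case 0
  then show ?case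
    by (intro exI[of _ "[]"]) simp
next
  case (Suc k)
  then obtain gs where gs: "valid_circuit n gs" "length gs \<le> k"
    "\<And>q. fold (gate_action n) gs q = (if bit q c then xor q (take_bit k m) else q)"
    by auto
  let ?hs = "gs @ (if bit m k then [CNOT_gate c k] else [])"
  have "fold (gate_action n) ?hs q = (if bit q c then xor q (take_bit (Suc k) m) else q)" for q
    using assms(3) by (intro bit_eqI) (auto simp: gs bit_simps less_Suc_eq)
  moreover have "valid_circuit n ?hs" "length ?hs \<le> Suc k"
    using gs Suc.prems assms by auto
  ultimately show ?case
    by blast
qed

lemma CNOT_circuit_to_one:
  assumes "a < 2 ^ n" "a \<noteq> 0"
  shows "\<exists>gs. valid_circuit n gs \<and> length gs \<le> n + 1 \<and>
    fold (gate_action n) gs 0 = 0 \<and> fold (gate_action n) gs a = 1"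
proof -
  have "0 < n"
    using assms by (cases n) auto
  have odd_case: "\<exists>gs. valid_circuit n gs \<and> length gs \<le> n \<and>
    fold (gate_action n) gs 0 = 0 \<and> fold (gate_action n) gs a = 1"
    if "a < 2 ^ n" "odd a" for a
  proof -
    \<comment> \<open>For odd \<open>a\<close>, \<open>xor a 1\<close> collects the set bits other
      than bit 0. Qubit 0 can control their removal, which leaves 1.\<close>
    have "\<not> bit (xor a 1) 0"
      using that by (simp add: bit_0 xor_Suc_0_eq)
    then obtain gs where gs: "valid_circuit n gs" "length gs \<le> n"
      "\<And>q. fold (gate_action n) gs q = (if bit q 0 then xor q (take_bit n (xor a 1)) else q)"
      using CNOT_circuit_controlled_xor[of n n 0 "xor a 1"] \<open>0 < n\<close> by auto
    have "take_bit n (xor a 1) = xor a 1"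
      using that \<open>0 < n\<close> by (simp add: take_bit_nat_eq_self)
    then have "fold (gate_action n) gs a = 1" "fold (gate_action n) gs 0 = 0"
      using that by (simp_all add: gs bit_0 flip: xor.assoc)
    with gs show ?thesis by blast
  qed
  show ?thesis
  proof (cases "odd a")
    case True
    then show ?thesis
      using odd_case[of a] assms by (meson le_add1 le_trans)
  next
    case False
    \<comment> \<open>For even \<open>a\<close>, one extra CNOT from a set bit \<open>t\<close> to
      qubit 0 makes the label odd and fixes 0; it accounts for the \<open>+ 1\<close> in the length
      bound.\<close>
    obtain t where t: "bit a t"
      using assms bit_eq_iff[of a 0] by auto
    have "t < n"
      using t assms by (metis bit_take_bit_iff take_bit_nat_eq_self)
    have "t \<noteq> 0"
      using t False by (metis bit_0)
    have "flip_bit 0 a < 2 ^ n" "odd (flip_bit 0 a)"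
      using assms False \<open>0 < n\<close> by (auto simp: flip_bit_less_exp even_flip_bit_iff)
    then obtain gs where "valid_circuit n gs" "length gs \<le> n"
      "fold (gate_action n) gs 0 = 0" "fold (gate_action n) gs (flip_bit 0 a) = 1"
      using odd_case by blast
    then show ?thesis
      using t \<open>t < n\<close> \<open>t \<noteq> 0\<close> by (intro exI[of _ "CNOT_gate t 0 # gs"]) auto
  qed
qed

text \<open>The controls are all set exactly when \<open>q div 2\<close> has \<open>n - 1\<close>
  ones, that is, for the two largest labels, which differ only in bit 0.\<close>

lemma Toffoli_gate_action_eq_transpose:
  assumes "0 < n" "q < 2 ^ n"
  shows "gate_action n Toffoli_gate q = transpose (2 ^ n - 2) (2 ^ n - 1) q"
proof -
  obtain m where n: "n = Suc m"
    using assms(1) by (cases n) auto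
  have "(\<forall>j\<in>{1..<n}. bit q j) \<longleftrightarrow> (\<forall>j<m. bit (q div 2) j)"
    unfolding n by (auto simp: bit_Suc[symmetric] elim!: Suc_le_D[THEN exE])
  also have "\<dots> \<longleftrightarrow> q div 2 = 2 ^ m - 1"
  proof -
    have "q div 2 < 2 ^ m"
      using assms(2) n by auto
    then have "q div 2 = take_bit m (q div 2)"
      by (simp add: take_bit_nat_eq_self)
    moreover have "(2 ^ m - 1 :: nat) = mask m"
      by (simp add: mask_eq_exp_minus_1)
    ultimately show ?thesis
      by (auto simp: bit_eq_iff bit_take_bit_iff bit_mask_iff)
  qed
  finally have *: "(\<forall>j\<in>{1..<n}. bit q j) \<longleftrightarrow> q div 2 = 2 ^ m - 1" .
  have "flip_bit 0 q = (if even q then q + 1 else q - 1)"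
    by (cases "even q") (auto simp: flip_bit_0 elim!: evenE oddE)
  \<comment> \<open>This resolves the truncated subtractions: the two labels become
    \<open>2 * e\<close> and \<open>2 * e + 1\<close>.\<close>
  moreover obtain e where "(2::nat) ^ m = Suc e"
    by (metis not0_implies_Suc power_not_zero zero_neq_numeral)
  ultimately show ?thesis
    unfolding gate_action.simps * unfolding n
    by (auto simp: transpose_def elim!: oddE)
qed

lemma transpose_circuit:
  assumes "a < 2 ^ n" "b < 2 ^ n" "a \<noteq> b"
  shows "\<exists>gs. valid_circuit n gs \<and> length gs \<le> 9 * n \<and>
    (\<forall>q<2 ^ n. fold (gate_action n) gs q = transpose a b q)"
proof -
  have n: "0 < n"
    using assms by (cases n) auto
  obtain xs where xs: "valid_circuit n xs" "length xs \<le> n"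
    "\<And>q. fold (gate_action n) xs q = xor q b"
    using X_circuit_xor[of n n b] assms by (auto simp: take_bit_nat_eq_self)
  have "xor a b < 2 ^ n"
    using fold_gate_action_less_exp[OF xs(1) assms(1)] xs(3) by simp
  moreover have "xor a b \<noteq> 0"
    using assms(3) by (auto simp: bit_eq_iff bit_xor_iff)
  ultimately obtain cs where cs: "valid_circuit n cs" "length cs \<le> n + 1"
    "fold (gate_action n) cs 0 = 0" "fold (gate_action n) cs (xor a b) = 1"
    using CNOT_circuit_to_one by blast
  obtain ys where ys: "valid_circuit n ys" "length ys \<le> n"
    "\<And>q. fold (gate_action n) ys q = xor q (2 ^ n - 2)"
    using X_circuit_xor[of n n "2 ^ n - 2"] by (auto simp: take_bit_nat_eq_self)
  let ?hs = "xs @ cs @ ys"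
  let ?f = "fold (gate_action n) ?hs"
  \<comment> \<open>Translation by an even label sends 1 to its successor, so \<open>ys\<close>
    carries 0 and 1 to the pair exchanged by the Toffoli gate.\<close>
  have "even ((2::nat) ^ n - 2)"
    using n by simp
  then have "xor 1 (2 ^ n - 2) = (2::nat) ^ n - 2 + 1"
    using one_xor_eq[of "(2::nat) ^ n - 2"] by simp
  also have "\<dots> = 2 ^ n - 1"
    using n power_increasing[of 1 n "2::nat"] by simp
  finally have fa: "?f a = 2 ^ n - 1" and fb: "?f b = 2 ^ n - 2"
    by (simp_all add: xs cs ys)
  have hs: "valid_circuit n ?hs"
    using xs cs ys by simp
  note inverse = fold_gate_action_rev_inverse[OF hs]
  let ?gs = "?hs @ [Toffoli_gate] @ rev ?hs"
  have "fold (gate_action n) ?gs q = transpose a b q" if "q < 2 ^ n" for q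
  proof -
    have "inj ?f"
      by (metis injI inverse)
    have "fold (gate_action n) ?gs q =
        fold (gate_action n) (rev ?hs) (gate_action n Toffoli_gate (?f q))"
      by simp
    also have "gate_action n Toffoli_gate (?f q) = transpose (?f a) (?f b) (?f q)"
      using Toffoli_gate_action_eq_transpose[OF n fold_gate_action_less_exp[OF hs that]]
      by (simp only: fa fb transpose_commute)
    \<comment> \<open>An injective map carries the transposition of \<open>a\<close> and
      \<open>b\<close> to that of their images; the reversed circuit then strips off
      \<open>?f\<close>.\<close>
    also have "\<dots> = ?f (transpose a b q)"
      using \<open>inj ?f\<close> by (simp only: transpose_apply_commute transpose_def inj_eq split: if_split) simp
    finally show ?thesis
      by (simp only: inverse)
  qed
  moreover have "valid_circuit n ?gs"
    using hs n by simp
  \<comment> \<open>The count is at most \<open>2 * (3 * n + 1) + 1 = 6 * n + 3\<close>, and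
    \<open>n\<close> is at least 1.\<close>
  moreover have "length ?gs \<le> 9 * n"
    using xs(2) cs(2) ys(2) n by simp
  ultimately show ?thesis by blast
qed

subsection \<open>Circuits for permutations\<close>

text \<open>Induction on \<open>N\<close> with the register size \<open>n\<close> fixed: following
  \<open>p\<close> by the transposition of \<open>N\<close> and \<open>p N\<close> makes
  \<open>N\<close> a fixed point. The same transposition, appended to the circuit of the remaining
  permutation \<open>r\<close>, restores \<open>p\<close>.\<close>

lemma permutation_circuit:
  assumes "p permutes {..<N}" "N \<le> 2 ^ n"
  shows "\<exists>gs. valid_circuit n gs \<and> length gs \<le> N * (9 * n) \<and>
    (\<forall>q<2 ^ n. fold (gate_action n) gs q = p q)"
  using assms
proof (induction N arbitrary: p)
  case 0
  then show ?case
    by (intro exI[of _ "[]"]) simp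
next
  case (Suc N)
  define r where "r = transpose N (p N) \<circ> p"
  have "r permutes {..<N}"
    using permutes_insert_lemma[of p N "{..<N}"] Suc.prems by (simp add: r_def lessThan_Suc)
  then obtain gs where gs: "valid_circuit n gs" "length gs \<le> N * (9 * n)"
    "\<And>q. q < 2 ^ n \<Longrightarrow> fold (gate_action n) gs q = r q"
    using Suc by (meson Suc_leD)
  have "p N < 2 ^ n" "N < 2 ^ n"
    using Suc.prems permutes_in_image[of p "{..<Suc N}" N] by auto
  then obtain ts where ts: "valid_circuit n ts" "length ts \<le> 9 * n"
    "\<And>q. q < 2 ^ n \<Longrightarrow> fold (gate_action n) ts q = transpose N (p N) q"
  \<comment> \<open>\<open>transpose_circuit\<close> needs distinct labels; when they coincide the
    empty circuit serves.\<close>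
  proof (cases "p N = N")
    case True
    then show ?thesis
      using that[of "[]"] by simp
  next
    case False
    then show ?thesis
      using that transpose_circuit[of N n "p N"] \<open>p N < 2 ^ n\<close> \<open>N < 2 ^ n\<close> by metis
  qed
  have "fold (gate_action n) (gs @ ts) q = p q" if "q < 2 ^ n" for q
    using gs(3)[OF that] fold_gate_action_less_exp[OF gs(1) that] by (simp add: ts r_def)
  moreover have "valid_circuit n (gs @ ts)" "length (gs @ ts) \<le> Suc N * (9 * n)"
    using gs ts by simp_all
  ultimately show ?case by blast
qed

theorem mainTheorem6:
  shows "\<exists>C::real. \<forall>N::nat. N \<ge> 2 \<longrightarrow>
    (\<forall>p::nat \<Rightarrow> nat. p permutes {..<N} \<longrightarrow>
      (\<exists>gs. implements (nat \<lceil>log 2 (real N)\<rceil>) gs p \<and>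
            real (length gs) \<le> C * (real N ^ 2 * log 2 (real N))))"
proof (intro exI[of _ 18] allI impI)
  fix N :: nat and p :: "nat \<Rightarrow> nat"
  assume N: "2 \<le> N" and p: "p permutes {..<N}"
  define n where "n = nat \<lceil>log 2 (real N)\<rceil>"
  have log_ge: "1 \<le> log 2 (real N)"
    using N by simp
  \<comment> \<open>The ceiling adds less than 1, which is at most the logarithm itself since
    \<open>N\<close> is at least 2. This factor 2 and the 9 of \<open>permutation_circuit\<close>
    give the constant 18.\<close>
  then have n_ge: "log 2 (real N) \<le> real n" and n_le: "real n \<le> 2 * log 2 (real N)"
    unfolding n_def by linarith+
  have "real N \<le> 2 powr real n"
    using n_ge N by (simp add: log_le_iff)
  then have "N \<le> 2 ^ n"
    by (simp add: powr_realpow)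
  then obtain gs where gs: "valid_circuit n gs" "length gs \<le> N * (9 * n)"
    "\<And>q. q < 2 ^ n \<Longrightarrow> fold (gate_action n) gs q = p q"
    using permutation_circuit[OF p] by blast
  have "implements n gs p"
    using gs by (simp add: implements_def circuit_unitary_eq_basis_map_matrix
        basis_map_matrix_cong[of n "fold (gate_action n) gs" p])
  moreover have "real (length gs) \<le> 18 * (real N ^ 2 * log 2 (real N))"
  proof -
    have "real (length gs) \<le> real N * (9 * real n)"
      using gs(2) by (metis of_nat_le_iff of_nat_mult of_nat_numeral)
    \<comment> \<open>The circuit has length of order \<open>N * log 2 N\<close>; the bound is
      relaxed here to the claimed one by \<open>N\<close> \<le> \<open>N ^ 2\<close>.\<close>
    also have "\<dots> \<le> real N ^ 2 * (9 * (2 * log 2 (real N)))"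
      using N n_le by (intro mult_mono) (auto simp: power2_eq_square)
    finally show ?thesis by simp
  qed
  ultimately show "\<exists>gs. implements (nat \<lceil>log 2 (real N)\<rceil>) gs p \<and>
      real (length gs) \<le> 18 * (real N ^ 2 * log 2 (real N))"
    unfolding n_def by blast
qed

end
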